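(* Let $P(x)$ be a nonlinear polynomial with real coefficients. If $P(x)$ has no irrational coefficients other than (possibly) the constant term, then there exist infinitely many mutually (pairwise) coprime integers $m\geq 2$ such that the sequence $(\lfloor P(k)\rfloor)_{k\geq 1}$ is not u.d. mod $m$.
   Context: A nonlinear polynomial is a polynomial of degree at least $2$. An integer sequence $(a_k)_{k\geq 1}$ is u.d. (uniformly distributed) mod an integer $m\geq 2$ if for every integer $i$, $\lim_{N\to\infty}\frac{1}{N}\#\{k\in\{1,\ldots,N\}: a_k\equiv i \pmod m\}=\frac{1}{m}$. Here $\lfloor r\rfloor$ denotes the greatest integer not exceeding $r$. *)

theory Defs
  imports Complex_Main
    "HOL-Computational_Algebra.Polynomial"
    "HOL-Number_Theory.Cong"
begin

(* Sequences are indexed from 1; the value a 0 is never used.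
   The notion is intended for moduli m \<ge> 2. *)
definition ud_mod :: "(nat \<Rightarrow> int) \<Rightarrow> int \<Rightarrow> bool" where
  "ud_mod a m \<longleftrightarrow>
     (\<forall>i::int. (\<lambda>N::nat. real (card {k \<in> {1..N}. [a k = i] (mod m)}) / real N)
                 \<longlonglongrightarrow> 1 / real_of_int m)"

end

theory Submission
  imports Defs
begin

text \<open>
  Write \<open>P = c + x * Q\<close> with \<open>Q\<close> rational, and let \<open>D > 0\<close> be a common denominator of the
  coefficients of \<open>Q\<close>. An irrational constant term disappears under the floor: with
  \<open>g = \<lfloor>D * c\<rfloor> + x * (D * Q)\<close>, a polynomial with integer coefficients, \<open>\<lfloor>P k\<rfloor> = g k div D\<close>
  (\<open>floor_poly_eq_int_poly_div\<close>).

  The moduli are the squares of the primes \<open>p > D\<close> that divide some value \<open>g' x\<close> of the derivative.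
  For such a prime, the Taylor expansion of \<open>g\<close> at \<open>x\<close> shows that \<open>g\<close> is constant modulo
  \<open>D * p\<^sup>2\<close> on the progression \<open>x + p * D * t\<close>: the linear term contains \<open>p * D\<close> from the step and
  another \<open>p\<close> from \<open>g' x\<close>, and the remainder contains \<open>(p * D)\<^sup>2\<close>. So \<open>\<lfloor>P k\<rfloor>\<close> is constant modulo
  \<open>p\<^sup>2\<close> on a set of density \<open>1 / (p * D)\<close>. Since \<open>p > D\<close>, this exceeds the density \<open>1 / p\<^sup>2\<close> of a
  single residue in the uniformly distributed case (\<open>not_ud_mod_if_constant_on_progression\<close>).

  As \<open>P\<close> is nonlinear, \<open>g'\<close> is not constant, so by a theorem of Schur its values have infinitely
  many prime divisors (\<open>infinite_prime_divisors_of_values\<close>), and squares of distinct primes are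
  coprime.
\<close>

text \<open>
  This is Euclid's argument. If \<open>c = h 0\<close> is nonzero, then \<open>h (c\<^sup>2 * B! * t) = c * u\<close> with \<open>u\<close>
  congruent to \<open>1\<close> modulo \<open>B!\<close>, so every prime divisor of \<open>u\<close> exceeds \<open>B\<close>. As
  \<open>h\<close> is not constant, \<open>u\<close> is \<open>0\<close>, \<open>1\<close> or \<open>-1\<close> for only finitely many \<open>t\<close>, and for any other
  \<open>t\<close> such a divisor exists.
\<close>

lemma infinite_prime_divisors_of_values:
  fixes h :: "int poly"
  assumes "degree h \<ge> 1"
  shows "infinite {p::nat. prime p \<and> (\<exists>x::nat. int p dvd poly h (int x))}"
  unfolding infinite_nat_iff_unbounded
proof
  fix B :: nat
  define c where "c = poly h 0"
  show "\<exists>p>B. p \<in> {p. prime p \<and> (\<exists>x::nat. int p dvd poly h (int x))}"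
  proof (cases "c = 0")
    case True
    obtain p where "prime p" "p > B" using bigger_prime by blast
    moreover have "int p dvd poly h (int 0)" using True by (simp add: c_def)
    ultimately show ?thesis by blast
  next
    case False
    define N :: nat where "N = nat (c\<^sup>2) * fact B"
    have N: "N > 0" using False by (simp add: N_def)
    \<comment> \<open>The roots of \<open>r\<close> are the arguments at which \<open>h\<close> takes one of the values \<open>0\<close>, \<open>c\<close>, \<open>-c\<close>.\<close>
    define r where "r = h * ((h - [:c:]) * (h + [:c:]))"
    have "h \<noteq> [:a:]" for a using assms by auto
    then have "h \<noteq> 0" "h - [:c:] \<noteq> 0" "h + [:c:] \<noteq> 0"
      using assms by (auto simp: add_eq_0_iff2)
    then have "finite {y. poly r y = 0}" unfolding r_def by (intro poly_roots_finite) simp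
    moreover have "infinite (range (\<lambda>t. int (N * t)))"
      using N by (intro range_inj_infinite) (auto simp: inj_on_def)
    ultimately obtain t where t: "poly r (int (N * t)) \<noteq> 0"
      by (metis (mono_tags, lifting) finite_subset image_subset_iff mem_Collect_eq)
    define x where "x = N * t"
    obtain a q where h: "h = pCons a q" by (cases h)
    define u where "u = 1 + c * fact B * int t * poly q (int x)"
    have "int x = c * (c * fact B * int t)"
      by (simp add: x_def N_def power2_eq_square)
    then have hx: "poly h (int x) = c * u"
      using h by (simp add: u_def c_def algebra_simps)
    have "u \<noteq> 0" "\<not> is_unit u"
      using t hx by (auto simp: r_def x_def[symmetric] zdvd1_eq abs_if split: if_splits)
    then obtain s where s: "prime s" "s dvd u"
      using prime_divisor_exists by blast
    define p where "p = nat s"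
    have p: "prime p" "int p = s"
      using s prime_ge_0_int[of s] by (auto simp: p_def)
    have "p > B"
    proof (rule ccontr)
      assume "\<not> p > B"
      then have "p dvd fact B" using p(1) by (simp add: prime_dvd_fact_iff)
      then have "int p dvd fact B"
        by (metis int_dvd_int_iff of_nat_fact)
      then have "s dvd c * fact B * int t * poly q (int x)"
        using p(2) by (simp add: dvd_mult dvd_mult2)
      then have "s dvd 1"
        using s(2) unfolding u_def by (simp add: dvd_add_left_iff)
      then show False using s(1) by auto
    qed
    moreover have "int p dvd poly h (int x)" using hx s p by simp
    ultimately show ?thesis using p(1) by blast
  qed
qed

lemma poly_taylor_first_order:
  fixes g :: "'a::idom poly"
  shows "\<exists>q. poly g (x + y) = poly g x + y * poly (pderiv g) x + y\<^sup>2 * q"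
proof (induction g)
  case 0
  show ?case by (intro exI[of _ 0]) simp
next
  case (pCons a g)
  then obtain q where q: "poly g (x + y) = poly g x + y * poly (pderiv g) x + y\<^sup>2 * q"
    by blast
  show ?case
    by (rule exI[of _ "poly (pderiv g) x + (x + y) * q"])
      (simp add: q pderiv_pCons algebra_simps power2_eq_square)
qed

lemma int_poly_div_cong_on_progression:
  fixes g :: "int poly" and D n x t :: int
  assumes "D > 0" and "n dvd poly (pderiv g) x"
  shows "[poly g (x + n * D * t) div D = poly g x div D] (mod n\<^sup>2)"
proof -
  from assms(2) obtain w where w: "poly (pderiv g) x = n * w" by (elim dvdE)
  obtain q where "poly g (x + n * D * t) = poly g x + (n * D * t) * poly (pderiv g) x
      + (n * D * t)\<^sup>2 * q"
    using poly_taylor_first_order by blast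
  then have "poly g (x + n * D * t) = poly g x + D * (n\<^sup>2 * (t * w + D * t\<^sup>2 * q))"
    by (simp add: w algebra_simps power2_eq_square)
  then have "poly g (x + n * D * t) div D = n\<^sup>2 * (t * w + D * t\<^sup>2 * q) + poly g x div D"
    using assms(1) by simp
  then show ?thesis by (simp add: cong_def)
qed

text \<open>
  Along the cut-offs \<open>N = x + L * j\<close> the residue of \<open>a x\<close> is hit at least \<open>j\<close> times, so its
  frequency, if it has a limit, tends to at least \<open>1 / L > 1 / m\<close>.
\<close>

lemma not_ud_mod_if_constant_on_progression:
  fixes a :: "nat \<Rightarrow> int" and x L :: nat and m :: int
  assumes L: "0 < L" "int L < m"
    and const: "\<And>t. [a (x + L * t) = a x] (mod m)"
  shows "\<not> ud_mod a m"
proof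
  assume "ud_mod a m"
  define S where "S N = {k \<in> {1..N}. [a k = a x] (mod m)}" for N
  have "(\<lambda>N. real (card (S N)) / real N) \<longlonglongrightarrow> 1 / real_of_int m"
    using \<open>ud_mod a m\<close> by (simp add: ud_mod_def S_def)
  moreover have "filterlim (\<lambda>j. x + L * j) at_top sequentially"
    using L(1) by (intro filterlim_subseq strict_monoI) simp
  ultimately have "(\<lambda>j. real (card (S (x + L * j))) / real (x + L * j)) \<longlonglongrightarrow> 1 / real_of_int m"
    by (rule filterlim_compose)
  moreover have "(\<lambda>j. real j / real (x + L * j)) \<longlonglongrightarrow> 1 / real L"
  proof -
    have "(\<lambda>j. 1 / (real x / real j + real L)) \<longlonglongrightarrow> 1 / (0 + real L)"
      using L(1) by (intro tendsto_intros lim_const_over_n) auto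
    moreover have "\<forall>\<^sub>F j in sequentially. 1 / (real x / real j + real L) = real j / real (x + L * j)"
      using eventually_gt_at_top[of 0] by eventually_elim (simp add: field_simps)
    ultimately show ?thesis by (simp add: tendsto_cong)
  qed
  moreover have "real j / real (x + L * j) \<le> real (card (S (x + L * j))) / real (x + L * j)" for j
  proof -
    \<comment> \<open>Starting at \<open>t = 1\<close> keeps the indices positive, even for \<open>x = 0\<close>.\<close>
    have "(\<lambda>t. x + L * t) ` {1..j} \<subseteq> S (x + L * j)"
      using L(1) const by (auto simp: S_def Suc_le_eq)
    then have "card ((\<lambda>t. x + L * t) ` {1..j}) \<le> card (S (x + L * j))"
      by (intro card_mono) (auto simp: S_def)
    moreover have "card ((\<lambda>t. x + L * t) ` {1..j}) = j"
      using L(1) by (subst card_image) (auto simp: inj_on_def)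
    ultimately show ?thesis by (intro divide_right_mono) auto
  qed
  ultimately have "1 / real L \<le> 1 / real_of_int m"
    by (intro LIMSEQ_le) auto
  moreover have "1 / real_of_int m < 1 / real L"
    using L by (intro divide_strict_left_mono) auto
  ultimately show False by simp
qed

lemma rat_poly_common_denominator:
  fixes Q :: "real poly"
  assumes "\<forall>i. coeff Q i \<in> \<rat>"
  shows "\<exists>(D::int) f::int poly. D > 0 \<and> map_poly real_of_int f = smult (real_of_int D) Q"
  using assms
proof (induction Q)
  case 0
  show ?case by (intro exI[of _ 1] exI[of _ 0]) simp
next
  case (pCons a Q)
  have "\<forall>i. coeff Q i \<in> \<rat>" using pCons.prems by (metis coeff_pCons_Suc)
  with pCons.IH obtain D f where
    D: "D > 0" and f: "map_poly real_of_int f = smult (real_of_int D) Q"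
    by blast
  have "a \<in> \<rat>" using pCons.prems by (metis coeff_pCons_0)
  then obtain r s :: int where s: "s > 0" and a: "a = real_of_int r / real_of_int s"
    by (elim Rats_cases')
  have "map_poly real_of_int (pCons (r * D) (smult s f)) = smult (real_of_int (s * D)) (pCons a Q)"
    using s by (simp add: map_poly_pCons map_poly_smult f a)
  moreover have "s * D > 0" using s D by simp
  ultimately show ?case by blast
qed

lemma poly_map_poly_of_int:
  "poly (map_poly of_int f) (of_int x) = (of_int (poly f x) :: 'a::comm_ring_1)"
  by (induction f) (simp_all add: map_poly_pCons)

text \<open>
  Only the integer part of \<open>D * c\<close> matters, where \<open>c\<close> is the constant term: the rest of \<open>D * P\<close> takes
  integer values at integers, and a fractional part below \<open>1\<close> is invisible to division by \<open>D\<close> with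
  rounding down.
\<close>

lemma floor_poly_eq_int_poly_div:
  fixes P :: "real poly"
  assumes deg: "degree P \<ge> 1" and rat: "\<forall>i\<ge>1. coeff P i \<in> \<rat>"
  obtains D :: int and g :: "int poly"
  where "D > 0" "degree g = degree P"
    "\<And>k::int. \<lfloor>poly P (real_of_int k)\<rfloor> = poly g k div D"
proof -
  obtain c Q where P: "P = pCons c Q" by (cases P)
  have Q0: "Q \<noteq> 0" using deg P by auto
  have "\<forall>i. coeff Q i \<in> \<rat>" using rat P by (metis coeff_pCons_Suc le_add1 plus_1_eq_Suc)
  then obtain D f where
    D: "D > 0" and fQ: "map_poly real_of_int f = smult (real_of_int D) Q"
    using rat_poly_common_denominator by blast
  have f: "real_of_int (poly f x) = real_of_int D * poly Q (real_of_int x)" for x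
    using arg_cong[OF fQ, of "\<lambda>q. poly q (real_of_int x)"] by (simp add: poly_map_poly_of_int)
  have f0: "f \<noteq> 0" using fQ Q0 D by auto
  have "degree (map_poly real_of_int f) = degree f" by (rule degree_map_poly) simp
  then have degf: "degree f = degree Q" using fQ D by simp
  show ?thesis
  proof
    show "D > 0" by fact
    show "degree (pCons \<lfloor>real_of_int D * c\<rfloor> f) = degree P"
      using f0 Q0 degf P by simp
    fix k :: int
    have "poly P (real_of_int k)
        = (real_of_int D * c + real_of_int (k * poly f k)) / real_of_int D"
      using D by (simp add: P f field_simps)
    then have "\<lfloor>poly P (real_of_int k)\<rfloor> = \<lfloor>real_of_int D * c + real_of_int (k * poly f k)\<rfloor> div D"
      using D floor_divide_real_eq_div[of D] by simp
    then show "\<lfloor>poly P (real_of_int k)\<rfloor> = poly (pCons \<lfloor>real_of_int D * c\<rfloor> f) k div D"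
      by (simp add: floor_add_int[symmetric] del: of_int_mult)
  qed
qed

theorem theorem10:
  fixes P :: "real poly"
  assumes "degree P \<ge> 2"
    and "\<forall>i\<ge>1. coeff P i \<in> \<rat>"
  shows "\<exists>M :: int set. infinite M \<and> pairwise coprime M \<and>
           (\<forall>m\<in>M. m \<ge> 2 \<and> \<not> ud_mod (\<lambda>k. \<lfloor>poly P (real k)\<rfloor>) m)"
proof -
  obtain D :: int and g :: "int poly" where D: "D > 0" and deg: "degree g = degree P"
    and floor_P: "\<And>k::int. \<lfloor>poly P (real_of_int k)\<rfloor> = poly g k div D"
    using floor_poly_eq_int_poly_div[of P] assms by auto
  define A where "A = {p::nat. prime p \<and> (\<exists>x::nat. int p dvd poly (pderiv g) (int x))} - {..nat D}"
  define M where "M = (\<lambda>p. (int p)\<^sup>2) ` A"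
  have "degree (pderiv g) \<ge> 1" using assms(1) deg by (simp add: degree_pderiv)
  then have "infinite A"
    unfolding A_def by (intro Diff_infinite_finite infinite_prime_divisors_of_values) auto
  then have "infinite M"
    unfolding M_def by (subst finite_image_iff) (auto simp: inj_on_def)
  moreover have "pairwise coprime M"
    by (auto simp: pairwise_def M_def A_def intro: primes_coprime)
  moreover have "m \<ge> 2 \<and> \<not> ud_mod (\<lambda>k. \<lfloor>poly P (real k)\<rfloor>) m" if "m \<in> M" for m
  proof
    from that obtain p where "p \<in> A" and m: "m = (int p)\<^sup>2" by (auto simp: M_def)
    then obtain x where "prime p" "p > nat D" and x: "int p dvd poly (pderiv g) (int x)"
      by (auto simp: A_def)
    then have p: "prime p" "int p > D" by linarith+
    have lt: "int (p * nat D) < m"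
      using p D prime_gt_0_nat[of p] by (simp add: m power2_eq_square)
    have pos: "0 < p * nat D"
      using prime_gt_0_nat[OF p(1)] D by simp
    show "m \<ge> 2" using lt pos by linarith
    show "\<not> ud_mod (\<lambda>k. \<lfloor>poly P (real k)\<rfloor>) m"
    proof (rule not_ud_mod_if_constant_on_progression[OF pos lt])
      fix t
      have "\<lfloor>poly P (real k)\<rfloor> = poly g (int k) div D" for k
        using floor_P[of "int k"] by simp
      moreover have "int (x + p * nat D * t) = int x + int p * D * int t" using D by simp
      ultimately show "[\<lfloor>poly P (real (x + p * nat D * t))\<rfloor> = \<lfloor>poly P (real x)\<rfloor>] (mod m)"
        using int_poly_div_cong_on_progression[OF D x, of "int t"] by (simp only: m)
    qed
  qed
  ultimately show ?thesis by blast
qed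

end
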